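(* There is an absolute constant $A>0$ such that for every positive integer $n$, every set $P$ of $n$ points in the plane $\mathbb{R}^2$ has a geometric spanning tree with crossing number at most $A\sqrt{n}$.
   Context: Let $P$ be a finite set of points in $\mathbb{R}^2$. A geometric graph on $P$ is a graph with vertex set $P$ whose edges are realized as straight segments connecting the respective end-vertices (edges are allowed to cross one another). A geometric spanning tree on $P$ is an acyclic connected geometric graph on $P$. The crossing number of a geometric graph $G$ on $P$ is the maximum number of edges of $G$ that can be intersected simultaneously by a line not passing through any point of $P$. *)

theory Defs
  imports "HOL-Analysis.Analysis"
begin

text \<open>
  A graph on the vertex set \<open>P\<close> is given by its set \<open>E\<close> of edges, an edge being the two-element set
  of its end-vertices. The points may be in arbitrary position, so edges may overlap or pass through
  other vertices; the abstract graph structure is not affected by this.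
\<close>

definition geometric_graph :: "(real^2) set \<Rightarrow> (real^2) set set \<Rightarrow> bool" where
  "geometric_graph P E \<longleftrightarrow> finite P \<and> (\<forall>e\<in>E. e \<subseteq> P \<and> card e = 2)"

definition graph_connected :: "'a set \<Rightarrow> 'a set set \<Rightarrow> bool" where
  "graph_connected P E \<longleftrightarrow> (\<forall>u\<in>P. \<forall>v\<in>P. (\<lambda>x y. {x, y} \<in> E)\<^sup>*\<^sup>* u v)"

text \<open>A cycle is listed by its vertices, without repeating the starting vertex at the end.\<close>

definition graph_cycle :: "'a set set \<Rightarrow> 'a list \<Rightarrow> bool" where
  "graph_cycle E vs \<longleftrightarrow> length vs \<ge> 3 \<and> distinct vs \<and>
     successively (\<lambda>x y. {x, y} \<in> E) vs \<and> {last vs, hd vs} \<in> E"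

definition graph_acyclic :: "'a set set \<Rightarrow> bool" where
  "graph_acyclic E \<longleftrightarrow> (\<nexists>vs. graph_cycle E vs)"

definition geometric_spanning_tree :: "(real^2) set \<Rightarrow> (real^2) set set \<Rightarrow> bool" where
  "geometric_spanning_tree P E \<longleftrightarrow>
     geometric_graph P E \<and> graph_acyclic E \<and> graph_connected P E"

definition is_line :: "(real^2) set \<Rightarrow> bool" where
  "is_line L \<longleftrightarrow> affine L \<and> aff_dim L = 1"

definition line_meets_edge :: "(real^2) set \<Rightarrow> (real^2) set \<Rightarrow> bool" where
  "line_meets_edge L e \<longleftrightarrow> (\<exists>u v. e = {u, v} \<and> L \<inter> closed_segment u v \<noteq> {})"

definition crossing_counts :: "(real^2) set \<Rightarrow> (real^2) set set \<Rightarrow> nat set" where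
  "crossing_counts P E =
     {card {e \<in> E. line_meets_edge L e} | L. is_line L \<and> L \<inter> P = {}}"

definition crossing_number :: "(real^2) set \<Rightarrow> (real^2) set set \<Rightarrow> nat" where
  "crossing_number P E = Max (crossing_counts P E)"

text \<open>The maximum is attained: it ranges over a finite nonempty set of values.\<close>

lemma finite_edges:
  assumes "geometric_graph P E"
  shows "finite E"
proof (rule finite_subset)
  show "E \<subseteq> Pow P" using assms by (auto simp: geometric_graph_def)
  show "finite (Pow P)" using assms by (simp add: geometric_graph_def)
qed

lemma finite_crossing_counts:
  assumes "geometric_graph P E"
  shows "finite (crossing_counts P E)"
proof (rule finite_subset)
  show "crossing_counts P E \<subseteq> {..card E}"
    using finite_edges[OF assms] by (auto simp: crossing_counts_def intro: card_mono)
qed simp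

lemma crossing_counts_nonempty:
  assumes "geometric_graph P E"
  shows "crossing_counts P E \<noteq> {}"
proof -
  have "finite ((\<lambda>x. x $ 1) ` P)" using assms by (simp add: geometric_graph_def)
  then obtain c where c: "c \<notin> (\<lambda>x. x $ 1) ` P"
    using ex_new_if_finite[OF infinite_UNIV_char_0] by blast
  define L :: "(real^2) set" where "L = {x. axis 1 1 \<bullet> x = c}"
  have "is_line L"
    by (simp add: is_line_def L_def affine_hyperplane aff_dim_hyperplane axis_eq_0_iff)
  moreover have "L \<inter> P = {}"
    using c by (auto simp: L_def inner_axis' image_iff)
  ultimately show ?thesis by (auto simp: crossing_counts_def)
qed

end

theory Submission
  imports Defs
begin

text \<open>
  Any two points of the plane have a distance with respect to a weighted finite set of lines, namely
  the total weight of the lines that separate them. If \<open>k\<close> points are given and the lines have total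
  weight \<open>W\<close>, then some two of the points have distance \<open>O(W / sqrt k)\<close>
  (\<open>close_pair\<close>). Granting this, the tree is built by Welzl's reweighting
  (\<open>spanning_tree_small_potential\<close>): join a close pair, forget one of the two points, double the weight
  of the lines that separate the pair, and repeat. Only lines with different traces on \<open>P\<close> matter, and
  there are at most \<open>(n + 1)^3\<close> of these. They start with weight 1 each, so the final total weight is at
  most \<open>(n + 1)^3\<close> times the product of the factors \<open>1 + O(1 / sqrt k)\<close> for \<open>k \<le> n\<close>, that is,
  \<open>exp (O(sqrt n))\<close>. A line that crosses \<open>m\<close> edges contributes \<open>2^m\<close>, and therefore \<open>m = O(sqrt n)\<close>.

  The existence of a close pair is an instance of Haussler's packing lemma (\<open>haussler_packing\<close>). It is
  stated for an abstract set system, with the half-plane traces as sets, and the only geometric input is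
  that three lines do not realise all eight sign patterns, so that the dual VC dimension is at
  most 2 (\<open>vc_dim_dual_halfplane_traces\<close>). Likewise, the bound \<open>(n + 1)^3\<close> is the Sauer-Shelah lemma
  together with the fact that half-planes shatter no four points (\<open>vc_dim_halfplane_traces\<close>).
\<close>

section \<open>Shattering and VC dimension\<close>

definition shatters :: "'a set set \<Rightarrow> 'a set \<Rightarrow> bool" where
  "shatters F Y \<longleftrightarrow> (\<forall>Z\<subseteq>Y. \<exists>B\<in>F. B \<inter> Y = Z)"

text \<open>
  Subsets of a shattered set are shattered, so excluding the size \<open>Suc d\<close> excludes all larger sizes.
\<close>
definition vc_dim_le :: "nat \<Rightarrow> 'a set set \<Rightarrow> bool" where
  "vc_dim_le d F \<longleftrightarrow> (\<forall>Y. finite Y \<and> card Y = Suc d \<longrightarrow> \<not> shatters F Y)"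

lemma shattersD: "shatters F Y \<Longrightarrow> Z \<subseteq> Y \<Longrightarrow> \<exists>B\<in>F. B \<inter> Y = Z"
  by (auto simp: shatters_def)

lemma shatters_mono: "shatters F Y \<Longrightarrow> F \<subseteq> G \<Longrightarrow> shatters G Y"
  unfolding shatters_def by (meson subsetD)

lemma vc_dim_le_mono: "vc_dim_le d G \<Longrightarrow> F \<subseteq> G \<Longrightarrow> vc_dim_le d F"
  unfolding vc_dim_le_def by (meson shatters_mono)

lemma shatters_subset:
  assumes "shatters F Y" "F \<subseteq> Pow A"
  shows "Y \<subseteq> A"
proof -
  obtain B where "B \<in> F" "B \<inter> Y = Y" using shattersD[OF assms(1) order_refl] by auto
  then show ?thesis using assms(2) by auto
qed

lemma vc_dim_le_0_unique:
  assumes "vc_dim_le 0 F" "B \<in> F" "C \<in> F"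
  shows "B = C"
proof (rule ccontr)
  assume "B \<noteq> C"
  then obtain y where y: "y \<in> B \<and> y \<notin> C \<or> y \<in> C \<and> y \<notin> B" by blast
  have "shatters F {y}"
    unfolding shatters_def
  proof (intro allI impI)
    fix Z assume "Z \<subseteq> {y}"
    then have "Z = {} \<or> Z = {y}" by blast
    then show "\<exists>B\<in>F. B \<inter> {y} = Z" using y assms(2,3) by blast
  qed
  then show False using assms(1) by (auto simp: vc_dim_le_def)
qed

text \<open>
  Deleting one element \<open>x\<close> from the ground set turns a family \<open>F\<close> into two families on the remaining
  set \<open>A\<close>: the restrictions of members, and the sets that are restrictions of two members. Inductions
  on the ground set rest on the fact that the sizes of these two families add up to the size of \<open>F\<close>,
  and that the second one drops in VC dimension, since a set shattered by it can be enlarged by \<open>x\<close>.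
\<close>
lemma vc_dim_le_projection:
  assumes "vc_dim_le d F" "x \<notin> A"
  shows "vc_dim_le d {B \<in> Pow A. B \<in> F \<or> insert x B \<in> F}" (is "vc_dim_le d ?F'")
  unfolding vc_dim_le_def
proof (intro allI impI notI)
  fix Y assume Y: "finite Y \<and> card Y = Suc d" and sh: "shatters ?F' Y"
  have "Y \<subseteq> A" using shatters_subset[OF sh, of A] by blast
  have "shatters F Y"
    unfolding shatters_def
  proof (intro allI impI)
    fix Z assume "Z \<subseteq> Y"
    then obtain B where B: "B \<in> ?F'" "B \<inter> Y = Z" using shattersD[OF sh] by blast
    have "x \<notin> Y" using \<open>Y \<subseteq> A\<close> assms(2) by blast
    then have "insert x B \<inter> Y = Z" using B(2) by simp
    then show "\<exists>B\<in>F. B \<inter> Y = Z" using B by blast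
  qed
  then show False using assms Y by (auto simp: vc_dim_le_def)
qed

lemma vc_dim_le_doubled:
  assumes "vc_dim_le (Suc d) F" "x \<notin> A"
  shows "vc_dim_le d {B \<in> Pow A. B \<in> F \<and> insert x B \<in> F}" (is "vc_dim_le d ?F'")
  unfolding vc_dim_le_def
proof (intro allI impI notI)
  fix Y assume Y: "finite Y \<and> card Y = Suc d" and sh: "shatters ?F' Y"
  have "Y \<subseteq> A" using shatters_subset[OF sh, of A] by blast
  then have "x \<notin> Y" using assms(2) by blast
  have "shatters F (insert x Y)"
    unfolding shatters_def
  proof (intro allI impI)
    fix Z assume Z: "Z \<subseteq> insert x Y"
    have "Z - {x} \<subseteq> Y" using Z by blast
    then obtain B where B: "B \<in> ?F'" "B \<inter> Y = Z - {x}" using shattersD[OF sh] by blast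
    show "\<exists>B\<in>F. B \<inter> insert x Y = Z"
    proof (cases "x \<in> Z")
      case True
      then have "insert x B \<inter> insert x Y = Z" using B by auto
      then show ?thesis using B by blast
    next
      case False
      then have "B \<inter> insert x Y = Z" using B assms(2) by auto
      then show ?thesis using B by blast
    qed
  qed
  moreover have "card (insert x Y) = Suc (Suc d)" using Y \<open>x \<notin> Y\<close> by simp
  ultimately show False using assms(1) Y by (auto simp: vc_dim_le_def)
qed

lemma sum_Pow_insert:
  fixes f :: "'a set \<Rightarrow> 'b::comm_monoid_add"
  assumes "finite A" "x \<notin> A"
  shows "sum f (Pow (insert x A)) = (\<Sum>B\<in>Pow A. f B + f (insert x B))"
proof -
  have "inj_on (insert x) (Pow A)" using assms(2) by (auto simp: inj_on_def)
  moreover have "Pow A \<inter> insert x ` Pow A = {}" using assms(2) by auto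
  ultimately show ?thesis
    using assms(1) by (simp add: Pow_insert sum.union_disjoint sum.reindex sum.distrib)
qed

text \<open>
  Induction over the ground set with the two families above: \<open>n^(d+1) + n^d\<close> is at most
  \<open>(n+1)^(d+1)\<close>. This form is slightly weaker than the sum of binomial coefficients, but polynomial
  growth of degree \<open>d\<close> is all that matters for a bound up to constants.
\<close>
lemma sauer_shelah:
  assumes "finite A" "F \<subseteq> Pow A" "vc_dim_le d F"
  shows "card F \<le> Suc (card A) ^ d"
  using assms
proof (induction A arbitrary: d F rule: finite_induct)
  case empty
  then have "card F \<le> card {{} :: 'a set}" by (intro card_mono) auto
  then show ?case by simp
next
  case (insert x A)
  let ?F0 = "{B \<in> Pow A. B \<in> F}"
  let ?F1 = "{B \<in> Pow A. insert x B \<in> F}"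
  let ?n = "Suc (card A)"
  have un: "?F0 \<union> ?F1 = {B \<in> Pow A. B \<in> F \<or> insert x B \<in> F}"
    and int: "?F0 \<inter> ?F1 = {B \<in> Pow A. B \<in> F \<and> insert x B \<in> F}" by auto
  have fin: "finite ?F0" "finite ?F1" using insert.hyps by auto
  have "F \<subseteq> ?F0 \<union> insert x ` ?F1"
  proof
    fix B assume "B \<in> F"
    then have B: "B \<in> F" "B \<subseteq> insert x A" using insert.prems(1) by blast+
    show "B \<in> ?F0 \<union> insert x ` ?F1"
    proof (cases "x \<in> B")
      case True
      then have "B = insert x (B - {x})" by blast
      moreover from this have "B - {x} \<in> ?F1" using B by auto
      ultimately show ?thesis by blast
    next
      case False
      then show ?thesis using B by blast
    qed
  qed
  then have "card F \<le> card (?F0 \<union> insert x ` ?F1)" using fin by (intro card_mono) auto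
  also have "\<dots> \<le> card ?F0 + card (insert x ` ?F1)" by (rule card_Un_le)
  also have "\<dots> \<le> card ?F0 + card ?F1" using card_image_le[OF fin(2)] by simp
  also have "\<dots> = card (?F0 \<union> ?F1) + card (?F0 \<inter> ?F1)" using fin by (rule card_Un_Int)
  finally have split: "card F \<le> card (?F0 \<union> ?F1) + card (?F0 \<inter> ?F1)" .
  have P: "card (?F0 \<union> ?F1) \<le> ?n ^ d"
    using insert.prems(2) insert.hyps(2) unfolding un
    by (intro insert.IH vc_dim_le_projection) auto
  show ?case
  proof (cases d)
    case 0
    have "?F0 \<inter> ?F1 = {}"
    proof (rule ccontr)
      assume "?F0 \<inter> ?F1 \<noteq> {}"
      then obtain B where "B \<subseteq> A" "B \<in> F" "insert x B \<in> F" by blast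
      then have "x \<in> B" using vc_dim_le_0_unique[of F B "insert x B"] insert.prems(2) 0 by auto
      then show False using \<open>B \<subseteq> A\<close> insert.hyps(2) by blast
    qed
    then show ?thesis using split P 0 by simp
  next
    case (Suc d')
    have "card (?F0 \<inter> ?F1) \<le> ?n ^ d'"
      using insert.prems(2) insert.hyps(2) Suc unfolding int
      by (intro insert.IH vc_dim_le_doubled) auto
    then have "card F \<le> ?n ^ d + ?n ^ d'" using split P by simp
    also have "\<dots> = Suc ?n * ?n ^ d'" using Suc by simp
    also have "\<dots> \<le> Suc ?n * Suc ?n ^ d'" by (intro mult_left_mono power_mono) auto
    finally show ?thesis using Suc insert.hyps by simp
  qed
qed

section \<open>Edges of the weighted Hamming cube\<close>

text \<open>
  The four numbers are the weights at the corners of a square of the cube, with \<open>p\<close>, \<open>q\<close> and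
  \<open>r\<close>, \<open>s\<close> the ends of two parallel edges. Sorting along the other direction, so that
  the larger weights face each other, does not decrease the total weight of the two edges.
\<close>
lemma min_add_min_le_uncrossed:
  fixes p q r s :: nat
  shows "min p q + min r s \<le> min (max p r) (max q s) + min (min p r) (min q s)"
  by (cases "p \<le> q"; cases "r \<le> s"; cases "p \<le> r"; cases "q \<le> s") simp_all

text \<open>
  Read the subsets of \<open>A\<close> as the vertices of a cube, with an edge weighing as much as its lighter end.
  A family of VC dimension \<open>d\<close> spans at most \<open>d\<close> times as many edges as it has members, and this is
  the weighted form. To remove a coordinate \<open>x\<close>, give the larger of the weights at \<open>B\<close> and \<open>insert x B\<close> to one
  copy of the smaller cube and the smaller weight to another copy. The total is
  unchanged, the edges in the other directions only gain, and the edges in direction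
  \<open>x\<close> weigh exactly the total of the second copy. They are paid for by the drop of the VC dimension
  there, which makes the sum \<open>(d - 1) + 1\<close>.
\<close>
lemma weighted_edge_bound:
  fixes w :: "'a set \<Rightarrow> nat"
  assumes "finite A" "vc_dim_le d {B \<in> Pow A. 0 < w B}"
  shows "(\<Sum>a\<in>A. \<Sum>B\<in>Pow (A - {a}). min (w B) (w (insert a B))) \<le> d * (\<Sum>B\<in>Pow A. w B)"
  using assms
proof (induction A arbitrary: d w rule: finite_induct)
  case empty
  then show ?case by simp
next
  case (insert x A)
  let ?E = "\<lambda>A w. \<Sum>a\<in>A. \<Sum>B\<in>Pow (A - {a}). min (w B) (w (insert a B) :: nat)"
  let ?up = "\<lambda>B. max (w B) (w (insert x B))"
  let ?lo = "\<lambda>B. min (w B) (w (insert x B))"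
  let ?F = "{B \<in> Pow (insert x A). 0 < w B}"
  have minus: "insert x A - {x} = A" using insert.hyps by auto
  have minus': "insert x A - {a} = insert x (A - {a})" if "a \<in> A" for a
    using that insert.hyps by auto
  have "?E (insert x A) w = sum ?lo (Pow A) +
      (\<Sum>a\<in>A. \<Sum>B\<in>Pow (A - {a}). min (w B) (w (insert a B)) +
         min (w (insert x B)) (w (insert x (insert a B))))"
    using insert.hyps by (simp add: minus minus' sum_Pow_insert insert_commute)
  also have "\<dots> \<le> sum ?lo (Pow A) +
      (\<Sum>a\<in>A. \<Sum>B\<in>Pow (A - {a}). min (?up B) (?up (insert a B)) + min (?lo B) (?lo (insert a B)))"
    by (intro add_left_mono sum_mono min_add_min_le_uncrossed)
  also have "\<dots> = sum ?lo (Pow A) + ?E A ?up + ?E A ?lo"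
    by (simp add: sum.distrib)
  finally have split: "?E (insert x A) w \<le> sum ?lo (Pow A) + ?E A ?up + ?E A ?lo" .
  have "w B + w (insert x B) = ?up B + ?lo B" for B by (simp add: max_def min_def)
  then have total: "sum w (Pow (insert x A)) = sum ?up (Pow A) + sum ?lo (Pow A)"
    using insert.hyps by (simp add: sum_Pow_insert flip: sum.distrib)
  have up: "?E A ?up \<le> d * sum ?up (Pow A)"
  proof (rule insert.IH[where w = ?up])
    show "vc_dim_le d {B \<in> Pow A. 0 < ?up B}"
      using vc_dim_le_projection[OF insert.prems insert.hyps(2)]
      by (rule vc_dim_le_mono) (auto simp: less_max_iff_disj)
  qed
  show ?case
  proof (cases d)
    case 0
    have lo: "?lo B = 0" if "B \<in> Pow A" for B
    proof (rule ccontr)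
      assume "?lo B \<noteq> 0"
      then have "B = insert x B"
        using that insert.prems 0 by (intro vc_dim_le_0_unique[of ?F]) auto
      then show False using that insert.hyps(2) by blast
    qed
    have "min (?lo B) (?lo (insert a B)) = 0" if "B \<in> Pow (A - {a})" for a B
    proof -
      have "?lo B = 0" using that by (intro lo) blast
      then show ?thesis by simp
    qed
    then have "?E A ?lo = 0" by simp
    moreover have "sum ?lo (Pow A) = 0" using lo by simp
    ultimately show ?thesis using split up 0 by simp
  next
    case (Suc d')
    have "?E A ?lo \<le> d' * sum ?lo (Pow A)"
    proof (rule insert.IH[where w = ?lo])
      show "vc_dim_le d' {B \<in> Pow A. 0 < ?lo B}"
        using vc_dim_le_doubled[OF insert.prems[unfolded Suc] insert.hyps(2)]
        by (rule vc_dim_le_mono) auto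
    qed
    then have "sum ?lo (Pow A) + ?E A ?lo \<le> d * sum ?lo (Pow A)" using Suc by simp
    then have "?E (insert x A) w \<le> d * sum ?up (Pow A) + d * sum ?lo (Pow A)"
      using split up by linarith
    then show ?thesis unfolding total by (simp add: distrib_left)
  qed
qed

section \<open>The packing lemma\<close>

definition separation :: "'p set set \<Rightarrow> ('p set \<Rightarrow> real) \<Rightarrow> 'p \<Rightarrow> 'p \<Rightarrow> real" where
  "separation X \<mu> p q = (\<Sum>S\<in>X. \<mu> S * of_bool ((p \<in> S) \<noteq> (q \<in> S)))"

lemma sum_separated_pairs:
  assumes "finite Q"
  shows "(\<Sum>p\<in>Q. \<Sum>q\<in>Q. of_bool ((p \<in> S) \<noteq> (q \<in> S))) = 2 * real (card (Q - S)) * real (card (Q \<inter> S))"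
proof -
  have inner: "(\<Sum>q\<in>Q. of_bool ((p \<in> S) \<noteq> (q \<in> S)) :: real) =
      (if p \<in> S then real (card (Q - S)) else real (card (Q \<inter> S)))" for p
    using assms by (auto simp: Int_def set_diff_eq)
  show ?thesis
    unfolding inner using assms by (simp add: sum.If_cases Diff_eq Int_def Compl_eq)
qed

text \<open>
  If the points of \<open>Q\<close> are pairwise far apart, a random set \<open>S\<close> splits \<open>Q\<close> in a balanced way on average.
  The number of pairs split by \<open>S\<close> is the product of the sizes of both parts, which is at most
  \<open>card Q\<close> times the smaller size, and the expected number of split pairs is large
  because each pair contributes its separation.
\<close>
lemma sum_smaller_part_ge:
  assumes "finite X" "finite Q" "\<And>S. S \<in> X \<Longrightarrow> 0 \<le> \<mu> S" "Q \<noteq> {}"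
    and sep: "\<And>p q. p \<in> Q \<Longrightarrow> q \<in> Q \<Longrightarrow> p \<noteq> q \<Longrightarrow> \<delta> \<le> separation X \<mu> p q"
  shows "(real (card Q) - 1) * \<delta> / 2 \<le> (\<Sum>S\<in>X. \<mu> S * real (min (card (Q - S)) (card (Q \<inter> S))))"
    (is "_ \<le> ?M")
proof -
  define b where "b = real (card Q)"
  have b: "b > 0" using assms(2,4) by (simp add: b_def card_gt_0_iff)
  have product: "real (card (Q - S)) * real (card (Q \<inter> S))
      \<le> b * real (min (card (Q - S)) (card (Q \<inter> S)))" for S
  proof -
    have "card (Q - S) \<le> card Q" "card (Q \<inter> S) \<le> card Q"
      using assms(2) by (auto intro: card_mono)
    then have "max (card (Q - S)) (card (Q \<inter> S)) \<le> card Q" by simp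
    then have "max (card (Q - S)) (card (Q \<inter> S)) * min (card (Q - S)) (card (Q \<inter> S))
        \<le> card Q * min (card (Q - S)) (card (Q \<inter> S))" by (rule mult_right_mono) simp
    then have "card (Q - S) * card (Q \<inter> S) \<le> card Q * min (card (Q - S)) (card (Q \<inter> S))"
      by (simp add: max_def min_def mult.commute split: if_splits)
    then show ?thesis unfolding b_def by (simp flip: of_nat_mult)
  qed
  have "b * ((b - 1) * \<delta>) = (\<Sum>p\<in>Q. \<Sum>q\<in>Q - {p}. \<delta>)"
    using assms(2) b by (simp add: b_def of_nat_diff Suc_leI card_gt_0_iff)
  also have "\<dots> \<le> (\<Sum>p\<in>Q. \<Sum>q\<in>Q - {p}. separation X \<mu> p q)"
    by (intro sum_mono sep) auto
  also have "\<dots> = (\<Sum>p\<in>Q. \<Sum>q\<in>Q. separation X \<mu> p q)"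
    using assms(2) by (intro sum.cong refl sum.mono_neutral_left) (auto simp: separation_def)
  also have "\<dots> = (\<Sum>S\<in>X. \<mu> S * (\<Sum>p\<in>Q. \<Sum>q\<in>Q. of_bool ((p \<in> S) \<noteq> (q \<in> S))))"
    unfolding separation_def sum_distrib_left
    by (simp add: sum.swap[of _ X Q])
  also have "\<dots> = (\<Sum>S\<in>X. \<mu> S * (2 * (real (card (Q - S)) * real (card (Q \<inter> S)))))"
    unfolding sum_separated_pairs[OF assms(2)] mult.assoc ..
  also have "\<dots> \<le> (\<Sum>S\<in>X. \<mu> S * (2 * (b * real (min (card (Q - S)) (card (Q \<inter> S))))))"
    by (intro sum_mono mult_left_mono product) (auto simp: assms(3))
  also have "\<dots> = b * (2 * ?M)"
    by (simp add: sum_distrib_left mult_ac)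
  finally show ?thesis using b by (simp add: b_def mult.commute)
qed

text \<open>
  Fubini for a weighted sum over sequences: if the average over the entry \<open>i\<close> is at least \<open>c\<close>
  whatever the other entries are, then so is the average over all sequences. The weights need not be
  normalised, which accounts for the powers of \<open>sum \<mu> X\<close>.
\<close>
lemma sum_over_sequences_ge:
  fixes \<mu> :: "'x \<Rightarrow> real" and h :: "('i \<Rightarrow> 'x) \<Rightarrow> real"
  assumes "finite J" "i \<notin> J" "\<And>x. x \<in> X \<Longrightarrow> 0 \<le> \<mu> x" "finite X"
    and avg: "\<And>a. a \<in> J \<rightarrow>\<^sub>E X \<Longrightarrow> c \<le> (\<Sum>x\<in>X. \<mu> x * h (a(i := x)))"
  shows "c * sum \<mu> X ^ card J \<le> (\<Sum>a\<in>insert i J \<rightarrow>\<^sub>E X. (\<Prod>j\<in>insert i J. \<mu> (a j)) * h a)"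
proof -
  have "(\<Sum>a\<in>insert i J \<rightarrow>\<^sub>E X. (\<Prod>j\<in>insert i J. \<mu> (a j)) * h a) =
      (\<Sum>(x, a)\<in>X \<times> (J \<rightarrow>\<^sub>E X). \<mu> x * (\<Prod>j\<in>J. \<mu> (a j)) * h (a(i := x)))"
    (is "?L = _")
  proof -
    have "(\<Prod>j\<in>J. \<mu> ((a(i := x)) j)) = (\<Prod>j\<in>J. \<mu> (a j))" for a x
      using assms(2) by (intro prod.cong) auto
    then show ?thesis
      using assms(1,2) inj_combinator[OF assms(2), of "\<lambda>_. X"]
      by (simp add: PiE_insert_eq sum.reindex case_prod_unfold)
  qed
  also have "\<dots> = (\<Sum>a\<in>J \<rightarrow>\<^sub>E X. (\<Prod>j\<in>J. \<mu> (a j)) * (\<Sum>x\<in>X. \<mu> x * h (a(i := x))))"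
    unfolding sum.cartesian_product[symmetric] sum_distrib_left
    by (subst sum.swap) (simp add: mult_ac)
  finally have eq: "?L = \<dots>" .
  have "c * sum \<mu> X ^ card J = (\<Sum>a\<in>J \<rightarrow>\<^sub>E X. (\<Prod>j\<in>J. \<mu> (a j)) * c)"
    using prod_sum_PiE[OF assms(1), of "\<lambda>_. X" "\<lambda>_. \<mu>"] assms(4)
    by (simp add: sum_distrib_left mult.commute)
  also have "\<dots> \<le> (\<Sum>a\<in>J \<rightarrow>\<^sub>E X. (\<Prod>j\<in>J. \<mu> (a j)) * (\<Sum>x\<in>X. \<mu> x * h (a(i := x))))"
    using assms(3) by (intro sum_mono mult_left_mono avg prod_nonneg) (auto simp: PiE_iff)
  finally show ?thesis using eq by simp
qed

definition dual_family :: "'p set \<Rightarrow> 'p set set \<Rightarrow> 'p set set set" where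
  "dual_family P X = (\<lambda>p. {S \<in> X. p \<in> S}) ` P"

text \<open>
  Sequences may repeat a set. Indices that carry the same set cannot be told apart by any point, so
  they never lie in a common shattered index set, and repetitions do not raise the VC dimension.
\<close>
lemma vc_dim_le_traces:
  assumes "vc_dim_le d (dual_family P X)" "a \<in> I \<rightarrow> X"
  shows "vc_dim_le d ((\<lambda>p. {i \<in> I. p \<in> a i}) ` P)" (is "vc_dim_le d ?F")
  unfolding vc_dim_le_def
proof (intro allI impI notI)
  fix Y assume Y: "finite Y \<and> card Y = Suc d" and sh: "shatters ?F Y"
  have YI: "Y \<subseteq> I" using shatters_subset[OF sh, of I] by blast
  have point: "\<exists>p\<in>P. \<forall>i\<in>Y. p \<in> a i \<longleftrightarrow> i \<in> Z" if "Z \<subseteq> Y" for Z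
    using shattersD[OF sh that] YI by blast
  have inj: "inj_on a Y"
  proof (rule inj_onI, rule ccontr)
    fix i j assume "i \<in> Y" "j \<in> Y" "a i = a j" "i \<noteq> j"
    then show False using point[of "{i}"] by auto
  qed
  have "shatters (dual_family P X) (a ` Y)"
    unfolding shatters_def
  proof (intro allI impI)
    fix Z assume Z: "Z \<subseteq> a ` Y"
    obtain p where p: "p \<in> P" "\<forall>i\<in>Y. p \<in> a i \<longleftrightarrow> a i \<in> Z"
      using point[of "{i \<in> Y. a i \<in> Z}"] by auto
    have "{S \<in> X. p \<in> S} \<inter> a ` Y = Z" using p(2) Z YI assms(2) by auto
    then show "\<exists>B\<in>dual_family P X. B \<inter> a ` Y = Z" using p(1) by (auto simp: dual_family_def)
  qed
  moreover have "finite (a ` Y)" "card (a ` Y) = Suc d" using Y card_image[OF inj] by auto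
  ultimately show False using assms(1) by (auto simp: vc_dim_le_def)
qed

text \<open>
  Haussler's packing lemma, by Chazelle's argument. Draw a sequence of \<open>s\<close> sets independently with
  probabilities proportional to \<open>\<mu>\<close>, and record for each point which of them contain it. The points
  thereby give weights to the vertices of an \<open>s\<close>-dimensional cube, and the total edge weight is at
  most \<open>d * card P\<close> for every sequence by \<open>weighted_edge_bound\<close>. On the other hand,
  condition on all entries but the one with index \<open>i\<close>. By \<open>sauer_shelah\<close> these
  distribute the points into at most \<open>s^d\<close> classes, and the remaining entry splits each class \<open>Q\<close>
  into two parts that sit at the ends of an edge in direction \<open>i\<close>. By \<open>sum_smaller_part_ge\<close> the expected weight of this edge is
  at least \<open>(card Q - 1) * \<delta> / 2\<close> divided by the total of \<open>\<mu>\<close>, so that the edges in direction \<open>i\<close>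
  weigh at least \<open>(card P - s^d) * \<delta> / 2\<close> in these units. Summing over the \<open>s\<close> directions
  gives the claim.
\<close>
lemma haussler_packing:
  assumes "finite P" "finite X" "\<And>S. S \<in> X \<Longrightarrow> 0 \<le> \<mu> S" "0 < sum \<mu> X"
    and vc: "vc_dim_le d (dual_family P X)"
    and sep: "\<And>p q. p \<in> P \<Longrightarrow> q \<in> P \<Longrightarrow> p \<noteq> q \<Longrightarrow> \<delta> \<le> separation X \<mu> p q"
    and "0 \<le> \<delta>"
  shows "real s * (real (card P) - real s ^ d) * \<delta> \<le> 2 * real d * real (card P) * sum \<mu> X"
proof (cases "s = 0")
  case True
  then show ?thesis using assms(4) by simp
next
  case False
  define n where "n = real (card P)"
  define W where "W = sum \<mu> X"
  define I where "I = {..<s}"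
  define pattern where "pattern a J p = {j \<in> J. p \<in> a j}" for a :: "nat \<Rightarrow> 'a set" and J p
  define cls where "cls a J B = {p \<in> P. pattern a J p = B}" for a J B
  \<comment> \<open>\<open>h i a\<close> is the total weight of the cube edges in direction \<open>i\<close> for the sequence \<open>a\<close>, where the weight
    of a vertex \<open>B\<close> is the number of points in its class.\<close>
  define h where "h i a = (\<Sum>B\<in>Pow (I - {i}). min (card (cls a I B)) (card (cls a I (insert i B))))" for i a
  define c where "c = (n - real s ^ d) * \<delta> / 2"
  have I: "finite I" "card I = s" by (auto simp: I_def)
  have cls_sum: "(\<Sum>B\<in>Pow J. card (cls a J B)) = card P" if "finite J" for a J
    using sum.group[of P "Pow J" "pattern a J" "\<lambda>_. 1::nat"] that assms(1)
    by (force simp: cls_def pattern_def)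
  have upper: "(\<Sum>i\<in>I. real (h i a)) \<le> real d * n" if "a \<in> I \<rightarrow>\<^sub>E X" for a
  proof -
    have "vc_dim_le d (pattern a I ` P)"
      unfolding pattern_def using that by (intro vc_dim_le_traces[OF vc]) auto
    then have "vc_dim_le d {B \<in> Pow I. 0 < card (cls a I B)}"
      by (rule vc_dim_le_mono) (auto simp: cls_def card_gt_0_iff)
    from weighted_edge_bound[OF I(1) this]
    have "(\<Sum>i\<in>I. h i a) \<le> d * card P" unfolding h_def cls_sum[OF I(1)] .
    then show ?thesis unfolding n_def by (simp flip: of_nat_sum of_nat_mult)
  qed
  have lower: "c \<le> (\<Sum>S\<in>X. \<mu> S * real (h i (a(i := S))))"
    if i: "i \<in> I" and a: "a \<in> (I - {i}) \<rightarrow>\<^sub>E X" for i a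
  proof -
    define J where "J = I - {i}"
    define F where "F = pattern a J ` P"
    have J: "finite J" "i \<notin> J" "I = insert i J" using I i by (auto simp: J_def)
    have FJ: "F \<subseteq> Pow J" by (auto simp: F_def pattern_def)
    have new: "cls (a(i := S)) I B = cls a J B - S" "cls (a(i := S)) I (insert i B) = cls a J B \<inter> S"
      if "B \<in> Pow J" for S B
    proof -
      have "pattern (a(i := S)) I p = (if p \<in> S then insert i (pattern a J p) else pattern a J p)" for p
        using J by (auto simp: pattern_def)
      moreover have "i \<notin> pattern a J p" for p using J(2) by (auto simp: pattern_def)
      moreover have "i \<notin> B" using that J(2) by auto
      ultimately show "cls (a(i := S)) I B = cls a J B - S"
          "cls (a(i := S)) I (insert i B) = cls a J B \<inter> S"
        by (auto simp: cls_def insert_ident split: if_splits)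
    qed
    have "vc_dim_le d F"
      unfolding F_def pattern_def using a by (intro vc_dim_le_traces[OF vc]) (auto simp: J_def)
    then have "card F \<le> Suc (card J) ^ d" by (intro sauer_shelah J FJ)
    also have "Suc (card J) = s" using J I by simp
    finally have cardF: "real (card F) \<le> real s ^ d" by (simp flip: of_nat_power)
    have "cls a J B = {}" if "B \<notin> F" for B using that by (auto simp: F_def cls_def)
    then have "(\<Sum>B\<in>F. card (cls a J B)) = card P"
      unfolding cls_sum[OF J(1), of a, symmetric]
      using FJ J(1) by (intro sum.mono_neutral_left) auto
    then have n: "n = (\<Sum>B\<in>F. real (card (cls a J B)))"
      unfolding n_def by (simp flip: of_nat_sum)
    have "c \<le> (n - real (card F)) * \<delta> / 2"
      unfolding c_def using cardF assms(7) by (intro divide_right_mono mult_right_mono) auto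
    also have "\<dots> = (\<Sum>B\<in>F. (real (card (cls a J B)) - 1) * \<delta> / 2)"
      unfolding n by (simp add: sum_subtractf flip: sum_divide_distrib sum_distrib_right)
    also have "\<dots> \<le> (\<Sum>B\<in>F. \<Sum>S\<in>X. \<mu> S * real (min (card (cls a J B - S)) (card (cls a J B \<inter> S))))"
    proof (intro sum_mono sum_smaller_part_ge assms(2,3) sep)
      fix B assume "B \<in> F"
      then show "cls a J B \<noteq> {}" by (auto simp: F_def cls_def)
    qed (use assms(1) in \<open>auto simp: cls_def\<close>)
    also have "\<dots> \<le> (\<Sum>B\<in>Pow J. \<Sum>S\<in>X. \<mu> S * real (min (card (cls a J B - S)) (card (cls a J B \<inter> S))))"
      using FJ J(1) assms(3) by (intro sum_mono2 sum_nonneg) auto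
    also have "\<dots> = (\<Sum>S\<in>X. \<mu> S * real (\<Sum>B\<in>Pow J. min (card (cls a J B - S)) (card (cls a J B \<inter> S))))"
      by (subst sum.swap) (simp add: sum_distrib_left)
    also have "\<dots> = (\<Sum>S\<in>X. \<mu> S * real (h i (a(i := S))))"
      unfolding h_def J_def[symmetric] by (simp add: new)
    finally show ?thesis .
  qed
  have "real s * (c * W ^ (s - 1)) = (\<Sum>i\<in>I. c * W ^ card (I - {i}))"
    using I by simp
  also have "\<dots> \<le> (\<Sum>i\<in>I. \<Sum>a\<in>I \<rightarrow>\<^sub>E X. (\<Prod>j\<in>I. \<mu> (a j)) * real (h i a))"
  proof (rule sum_mono)
    fix i assume i: "i \<in> I"
    then have "insert i (I - {i}) = I" by blast
    then show "c * W ^ card (I - {i}) \<le> (\<Sum>a\<in>I \<rightarrow>\<^sub>E X. (\<Prod>j\<in>I. \<mu> (a j)) * real (h i a))"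
      using sum_over_sequences_ge[of "I - {i}" i X \<mu> c "\<lambda>a. real (h i a)"] lower[OF i] I assms(2,3)
      unfolding W_def by simp
  qed
  also have "\<dots> = (\<Sum>a\<in>I \<rightarrow>\<^sub>E X. (\<Prod>j\<in>I. \<mu> (a j)) * (\<Sum>i\<in>I. real (h i a)))"
    by (subst sum.swap) (simp add: sum_distrib_left)
  also have "\<dots> \<le> (\<Sum>a\<in>I \<rightarrow>\<^sub>E X. (\<Prod>j\<in>I. \<mu> (a j)) * (real d * n))"
    using assms(3) by (intro sum_mono mult_left_mono upper prod_nonneg) (auto simp: PiE_iff)
  also have "\<dots> = real d * n * W ^ s"
    using prod_sum_PiE[OF I(1), of "\<lambda>_. X" "\<lambda>_. \<mu>"] assms(2) I
    by (simp add: W_def sum_distrib_left mult.commute)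
  also have "W ^ s = W * W ^ (s - 1)"
    using False by (simp flip: power_Suc)
  finally have "(real s * c) * W ^ (s - 1) \<le> (real d * n * W) * W ^ (s - 1)"
    by (simp add: mult_ac)
  then have "real s * c \<le> real d * n * W"
    using assms(4) by (simp add: W_def)
  then show ?thesis by (simp add: c_def n_def W_def)
qed

text \<open>
  For dual VC dimension 2 the best choice in the packing lemma is \<open>s\<close> of order \<open>sqrt n\<close>, small
  enough that the at most \<open>s^2\<close> classes use up only half of the \<open>n\<close> points.
\<close>
lemma close_pair:
  assumes "finite R" "2 \<le> card R" "finite X" "\<And>S. S \<in> X \<Longrightarrow> 0 \<le> \<mu> S"
    and vc: "vc_dim_le 2 (dual_family R X)"
  obtains p q where "p \<in> R" "q \<in> R" "p \<noteq> q"
    "separation X \<mu> p q \<le> 32 * sum \<mu> X / sqrt (real (card R))"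
proof -
  define n where "n = real (card R)"
  define W where "W = sum \<mu> X"
  define \<delta> where "\<delta> = 32 * W / sqrt n"
  have n: "n \<ge> 2" using assms(2) by (simp add: n_def)
  have W0: "W \<ge> 0" unfolding W_def using assms(4) by (rule sum_nonneg)
  have "\<exists>p\<in>R. \<exists>q\<in>R. p \<noteq> q \<and> separation X \<mu> p q \<le> \<delta>"
  proof (rule ccontr)
    assume "\<not> ?thesis"
    then have far: "\<delta> < separation X \<mu> p q" if "p \<in> R" "q \<in> R" "p \<noteq> q" for p q
      using that by (force simp: not_le)
    \<comment> \<open>Any pair farther apart than \<open>\<delta>\<close> provides the positive total weight that packing requires.\<close>
    obtain p q where pq: "p \<in> R" "q \<in> R" "p \<noteq> q"
      using assms(1,2) by (metis card_le_Suc0_iff_eq not_less_eq_eq numeral_2_eq_2)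
    have "separation X \<mu> p q \<le> W"
      unfolding separation_def W_def using assms(4) by (intro sum_mono) (simp add: mult_left_le)
    moreover have "\<delta> \<ge> 0" using W0 n by (simp add: \<delta>_def)
    ultimately have W: "W > 0" using far[OF pq] by linarith
    \<comment> \<open>With at least half of the points left over and \<open>s > sqrt n / 4\<close>, packing bounds the least distance
      by \<open>4 * n * W / (s * n / 2)\<close>, which is below \<open>32 * W / sqrt n\<close>.\<close>
    define s where "s = nat \<lfloor>sqrt (n / 2)\<rfloor>"
    have "1 \<le> \<lfloor>sqrt (n / 2)\<rfloor>" using n by (simp add: le_floor_iff)
    then have s: "real s \<le> sqrt (n / 2)" "sqrt (n / 2) < real s + 1" "real s \<ge> 1"
      unfolding s_def by linarith+
    have "(real s)\<^sup>2 \<le> (sqrt (n / 2))\<^sup>2" using s(1) by (rule power_mono) simp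
    then have s2: "n / 2 \<le> n - (real s)\<^sup>2" using n by simp
    have "sqrt n = sqrt 2 * sqrt (n / 2)" by (simp flip: real_sqrt_mult)
    also have "\<dots> \<le> 2 * sqrt (n / 2)"
      using real_sqrt_le_mono[of 2 4] n by (intro mult_right_mono) auto
    also have "\<dots> < 4 * real s" using s by linarith
    finally have "sqrt n < 4 * real s" .
    have "n / sqrt n = sqrt n" "n = sqrt n * sqrt n" using n by (simp_all add: real_div_sqrt)
    moreover have "sqrt n * sqrt n < sqrt n * (4 * real s)"
      using \<open>sqrt n < 4 * real s\<close> n by (intro mult_strict_left_mono) auto
    ultimately have "n < 4 * real s * (n / sqrt n)" by (simp add: mult.commute)
    then have less: "W * n < W * (4 * real s * (n / sqrt n))" using W by (rule mult_strict_left_mono)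
    have "4 * n * W = 4 * (W * n)" by simp
    also have "\<dots> < 4 * (W * (4 * real s * (n / sqrt n)))"
      using less by (rule mult_strict_left_mono) simp
    also have "\<dots> = real s * (n / 2) * \<delta>" by (simp add: \<delta>_def)
    also have "\<dots> \<le> real s * (n - (real s)\<^sup>2) * \<delta>"
      using s2 \<open>\<delta> \<ge> 0\<close> by (intro mult_right_mono mult_left_mono) auto
    also have "\<dots> \<le> 2 * real 2 * n * W"
      unfolding n_def W_def using far W \<open>\<delta> \<ge> 0\<close>
      by (intro haussler_packing assms) (auto simp: W_def intro: less_imp_le)
    finally show False by simp
  qed
  then show ?thesis using that unfolding \<delta>_def W_def n_def by blast
qed

section \<open>Growing trees by leaves\<close>

definition spanning_tree :: "'a set \<Rightarrow> 'a set set \<Rightarrow> bool" where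
  "spanning_tree R E \<longleftrightarrow> (\<forall>e\<in>E. e \<subseteq> R \<and> card e = 2) \<and> graph_acyclic E \<and> graph_connected R E"

text \<open>
  On a cycle, the vertex \<open>p\<close> would have two different neighbours, but \<open>q\<close> is its only one. The three
  cases below say where the list starts the cycle relative to \<open>p\<close>.
\<close>
lemma graph_acyclic_add_leaf:
  assumes "graph_acyclic E" "\<And>e. e \<in> E \<Longrightarrow> p \<notin> e"
  shows "graph_acyclic (insert {p, q} E)"
  unfolding graph_acyclic_def
proof
  let ?E = "insert {p, q} E"
  assume "\<exists>vs. graph_cycle ?E vs"
  then obtain vs where len: "3 \<le> length vs" and dist: "distinct vs"
    and succ: "successively (\<lambda>x y. {x, y} \<in> ?E) vs" and close: "{last vs, hd vs} \<in> ?E"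
    unfolding graph_cycle_def by blast
  have nbr: "y = q" if "{p, y} \<in> ?E \<or> {y, p} \<in> ?E" for y
    using that assms(2) by (auto simp: doubleton_eq_iff)
  show False
  proof (cases "p \<in> set vs")
    case True
    then obtain us ws where vs: "vs = us @ p # ws" by (meson split_list)
    have pred: "last us = q" if "us \<noteq> []"
      using that succ nbr unfolding vs by (simp add: successively_append_iff)
    have succ_p: "hd ws = q" if "ws \<noteq> []"
    proof (rule nbr)
      show "{p, hd ws} \<in> ?E \<or> {hd ws, p} \<in> ?E"
        using that succ unfolding vs by (cases ws) (simp_all add: successively_append_iff)
    qed
    consider "us = []" | "ws = []" | "us \<noteq> []" "ws \<noteq> []" by blast
    then show False
    proof cases
      case 1
      then obtain y z zs where ws: "ws = y # z # zs"
        using len unfolding vs by (cases ws; cases "tl ws") auto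
      have "last ws = q" by (rule nbr) (use close 1 ws in \<open>simp add: vs\<close>)
      then have "y = last (z # zs)" using succ_p ws by simp
      then have "y \<in> set (z # zs)" using last_in_set[of "z # zs"] by simp
      then show False using dist unfolding vs ws by simp
    next
      case 2
      then obtain y z zs where us: "us = y # z # zs"
        using len unfolding vs by (cases us; cases "tl us") auto
      have "hd us = q" by (rule nbr) (use close 2 us in \<open>simp add: vs\<close>)
      then have "y = last (z # zs)" using pred us by simp
      then have "y \<in> set (z # zs)" using last_in_set[of "z # zs"] by simp
      then show False using dist unfolding vs us by simp
    next
      case 3
      then have "q \<in> set us" "q \<in> set ws"
        using pred succ_p last_in_set[of us] hd_in_set[of ws] by auto
      then show False using dist unfolding vs by auto
    qed
  next
    case False
    have "successively (\<lambda>x y. {x, y} \<in> E) vs"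
      using succ by (rule successively_mono) (use False in \<open>auto simp: doubleton_eq_iff\<close>)
    moreover have "{last vs, hd vs} \<in> E"
      using close False len last_in_set[of vs] by (cases vs) (auto simp: doubleton_eq_iff)
    ultimately have "graph_cycle E vs" using len dist by (simp add: graph_cycle_def)
    then show False using assms(1) by (auto simp: graph_acyclic_def)
  qed
qed

lemma spanning_tree_add_leaf:
  assumes "spanning_tree R E" "p \<notin> R" "q \<in> R"
  shows "spanning_tree (insert p R) (insert {p, q} E)"
proof -
  let ?E = "insert {p, q} E"
  let ?adj = "\<lambda>x y. {x, y} \<in> ?E"
  have E: "\<And>e. e \<in> E \<Longrightarrow> e \<subseteq> R \<and> card e = 2" "graph_acyclic E" "graph_connected R E"
    using assms(1) by (auto simp: spanning_tree_def)
  have "p \<noteq> q" using assms by blast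
  have conn: "?adj\<^sup>*\<^sup>* u v" if "u \<in> R" "v \<in> R" for u v
  proof -
    have "(\<lambda>x y. {x, y} \<in> E)\<^sup>*\<^sup>* u v" using E(3) that by (auto simp: graph_connected_def)
    then show ?thesis by (rule rtranclp_mono[THEN predicate2D, rotated]) auto
  qed
  have pq: "?adj p q" "?adj q p" by (auto simp: insert_commute)
  have "?adj\<^sup>*\<^sup>* u v" if "u \<in> insert p R" "v \<in> insert p R" for u v
  proof -
    have "?adj\<^sup>*\<^sup>* u q"
      using that(1) conn[OF _ assms(3)] r_into_rtranclp[of ?adj, OF pq(1)] by blast
    moreover have "?adj\<^sup>*\<^sup>* q v"
      using that(2) conn[OF assms(3)] r_into_rtranclp[of ?adj, OF pq(2)] by blast
    ultimately show ?thesis by (rule rtranclp_trans)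
  qed
  then have "graph_connected (insert p R) ?E" by (simp add: graph_connected_def)
  moreover have "graph_acyclic ?E"
    using E(1) assms(2) by (intro graph_acyclic_add_leaf E(2)) blast
  moreover have "\<forall>e\<in>?E. e \<subseteq> insert p R \<and> card e = 2"
    using E(1) assms(3) \<open>p \<noteq> q\<close> by auto
  ultimately show ?thesis by (simp add: spanning_tree_def)
qed

section \<open>Iterative reweighting\<close>

definition cut :: "'a set \<Rightarrow> 'a set set \<Rightarrow> 'a set set" where
  "cut S E = {e \<in> E. e \<inter> S \<noteq> {} \<and> e - S \<noteq> {}}"

text \<open>
  This bounds the product of the factors \<open>1 + c / sqrt k\<close> by induction, as \<open>1 / sqrt x\<close> is at most
  twice the increment of the square root from \<open>x - 1\<close> to \<open>x\<close>.
\<close>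
lemma exp_sqrt_step:
  assumes "1 \<le> x" "0 \<le> c"
  shows "(1 + c / sqrt x) * exp (2 * c * sqrt (x - 1)) \<le> exp (2 * c * sqrt x)"
proof -
  have le: "sqrt (x - 1) \<le> sqrt x" "0 < sqrt x" using assms by auto
  have "1 = (sqrt x - sqrt (x - 1)) * (sqrt x + sqrt (x - 1))"
    using assms by (simp add: algebra_simps)
  also have "\<dots> \<le> (sqrt x - sqrt (x - 1)) * (2 * sqrt x)"
    using le by (intro mult_left_mono) auto
  finally have "1 / sqrt x \<le> 2 * (sqrt x - sqrt (x - 1))"
    using le by (simp add: field_simps)
  then have "c * (1 / sqrt x) \<le> c * (2 * (sqrt x - sqrt (x - 1)))"
    using assms(2) by (rule mult_left_mono)
  then have *: "c / sqrt x + 2 * c * sqrt (x - 1) \<le> 2 * c * sqrt x"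
    by (simp add: algebra_simps)
  have "(1 + c / sqrt x) * exp (2 * c * sqrt (x - 1)) \<le> exp (c / sqrt x) * exp (2 * c * sqrt (x - 1))"
    by (intro mult_right_mono exp_ge_add_one_self) auto
  also have "\<dots> \<le> exp (2 * c * sqrt x)"
    using * by (simp flip: exp_add)
  finally show ?thesis .
qed

text \<open>
  Welzl's reweighting. Join a close pair \<open>p\<close>, \<open>q\<close> by an edge, drop \<open>p\<close>, double
  the weight of all sets that separate the pair, and continue with the remaining points, to
  whose tree \<open>p\<close> is attached as a leaf. A set cut by the tree many times becomes so heavy
  that later pairs avoid being separated by it. With \<open>k\<close> points left, the total weight grows by a
  factor of at most \<open>1 + 32 / sqrt k\<close>, and in the end the weight of \<open>S\<close> has been doubled
  \<open>card (cut S E)\<close> times.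
\<close>
lemma spanning_tree_small_potential:
  assumes "finite R" "R \<noteq> {}" "finite X" "\<And>S. S \<in> X \<Longrightarrow> 0 \<le> \<mu> S"
    and "vc_dim_le 2 (dual_family R X)"
  shows "\<exists>E. spanning_tree R E \<and>
    (\<Sum>S\<in>X. \<mu> S * 2 ^ card (cut S E)) \<le> sum \<mu> X * exp (64 * sqrt (real (card R)))"
  using assms
proof (induction "card R" arbitrary: R \<mu> rule: less_induct)
  case less
  show ?case
  proof (cases "card R = 1")
    case True
    then obtain r where "R = {r}" by (auto simp: card_1_singleton_iff)
    then have "spanning_tree R {}"
      by (auto simp: spanning_tree_def graph_connected_def graph_acyclic_def graph_cycle_def)
    moreover have "sum \<mu> X * 1 \<le> sum \<mu> X * exp (64 * sqrt (real (card R)))"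
      using less.prems(4) by (intro mult_left_mono sum_nonneg) auto
    ultimately show ?thesis by (intro exI[of _ "{}"]) (simp add: cut_def)
  next
    case False
    then have "2 \<le> card R" using less.prems(1,2) by (metis One_nat_def Suc_1 Suc_leI card_gt_0_iff le_neq_implies_less)
    then obtain p q where pq: "p \<in> R" "q \<in> R" "p \<noteq> q"
      and close: "separation X \<mu> p q \<le> 32 * sum \<mu> X / sqrt (real (card R))"
      using close_pair[of R X \<mu>] less.prems by metis
    define R' where "R' = R - {p}"
    define \<nu> where "\<nu> S = \<mu> S * (1 + of_bool ((p \<in> S) \<noteq> (q \<in> S)))" for S
    have R': "R = insert p R'" "p \<notin> R'" "q \<in> R'" "finite R'" "card R = Suc (card R')"
      using pq less.prems(1) card_Suc_Diff1[of R p] by (auto simp: R'_def)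
    have "dual_family R' X \<subseteq> dual_family R X" using R'(1) by (auto simp: dual_family_def)
    then have "vc_dim_le 2 (dual_family R' X)" using less.prems(5) vc_dim_le_mono by blast
    then obtain E where tree: "spanning_tree R' E"
      and pot: "(\<Sum>S\<in>X. \<nu> S * 2 ^ card (cut S E)) \<le> sum \<nu> X * exp (64 * sqrt (real (card R')))"
      using less.hyps[of R' \<nu>] R' less.prems(3,4) by (auto simp: \<nu>_def)
    have "finite E"
      using tree R'(4) by (intro finite_subset[of E "Pow R'"]) (auto simp: spanning_tree_def)
    have "{p, q} \<notin> E" using tree R'(2) by (auto simp: spanning_tree_def)
    have step: "2 ^ card (cut S (insert {p, q} E)) = (1 + of_bool ((p \<in> S) \<noteq> (q \<in> S))) * (2 :: real) ^ card (cut S E)" for S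
    proof -
      have "cut S (insert {p, q} E) = (if (p \<in> S) \<noteq> (q \<in> S) then insert {p, q} (cut S E) else cut S E)"
        by (auto simp: cut_def)
      then show ?thesis
        using \<open>finite E\<close> \<open>{p, q} \<notin> E\<close> by (simp add: cut_def)
    qed
    have "sum \<nu> X = sum \<mu> X + separation X \<mu> p q"
      by (simp add: \<nu>_def separation_def distrib_left sum.distrib)
    also have "\<dots> \<le> sum \<mu> X * (1 + 32 / sqrt (real (card R)))"
      using close by (simp add: algebra_simps)
    finally have \<nu>: "sum \<nu> X \<le> \<dots>" .
    have "(\<Sum>S\<in>X. \<mu> S * 2 ^ card (cut S (insert {p, q} E))) \<le> sum \<nu> X * exp (64 * sqrt (real (card R')))"
      using pot by (simp add: step \<nu>_def mult.assoc)
    also have "\<dots> \<le> sum \<mu> X * (1 + 32 / sqrt (real (card R))) * exp (64 * sqrt (real (card R')))"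
      using \<nu> by (rule mult_right_mono) simp
    also have "\<dots> \<le> sum \<mu> X * exp (64 * sqrt (real (card R)))"
      unfolding mult.assoc using exp_sqrt_step[of "real (card R)" 32] R'(5) less.prems(4)
      by (intro mult_left_mono sum_nonneg) auto
    finally show ?thesis
      using spanning_tree_add_leaf[OF tree R'(2,3)] R'(1) by auto
  qed
qed

section \<open>Half-planes and lines\<close>

text \<open>
  The boundary lines are those that count for the crossing number. As they avoid \<open>P\<close>, both sides are
  open half-planes as far as \<open>P\<close> is concerned, which makes the sign arguments below strict.
\<close>
definition halfplane_traces :: "(real^2) set \<Rightarrow> (real^2) set set" where
  "halfplane_traces P = {{p \<in> P. c < a \<bullet> p} | a c. \<forall>p\<in>P. a \<bullet> p \<noteq> c}"

lemma halfplane_traces_subset: "halfplane_traces P \<subseteq> Pow P"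
  by (auto simp: halfplane_traces_def)

lemma halfplane_traceE:
  assumes "S \<in> halfplane_traces P"
  obtains a c where "\<forall>p\<in>P. a \<bullet> p \<noteq> c" "S = {p \<in> P. c < a \<bullet> p}"
  using assms unfolding halfplane_traces_def by blast

text \<open>
  Four points of the plane have a Radon partition, and no line separates its two parts.
\<close>
lemma vc_dim_halfplane_traces: "vc_dim_le 3 (halfplane_traces P)"
  unfolding vc_dim_le_def
proof (intro allI impI notI)
  fix Y :: "(real^2) set"
  assume Y: "finite Y \<and> card Y = Suc 3" and sh: "shatters (halfplane_traces P) Y"
  have YP: "Y \<subseteq> P" using shatters_subset[OF sh halfplane_traces_subset] .
  have "affine_dependent Y" using Y by (intro affine_dependent_biggerset) auto
  then obtain U V where UV: "U \<subseteq> Y" "V \<subseteq> Y" "U \<inter> V = {}" "convex hull U \<inter> convex hull V \<noteq> {}"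
    by (rule Radon)
  obtain B where "B \<in> halfplane_traces P" "B \<inter> Y = U" using shattersD[OF sh UV(1)] by blast
  then obtain a c where ac: "\<forall>p\<in>P. a \<bullet> p \<noteq> c" "{p \<in> P. c < a \<bullet> p} \<inter> Y = U"
    by (auto simp: halfplane_traces_def)
  have "U \<subseteq> {x. a \<bullet> x > c}" using ac(2) by auto
  then have "convex hull U \<subseteq> {x. a \<bullet> x > c}" by (intro hull_minimal convex_halfspace_gt)
  moreover have "V \<subseteq> {x. a \<bullet> x < c}"
  proof
    fix x assume "x \<in> V"
    then have "x \<in> P" "x \<notin> {p \<in> P. c < a \<bullet> p}" using ac(2) UV(2,3) YP by blast+
    then have "\<not> c < a \<bullet> x" "a \<bullet> x \<noteq> c" using ac(1) by auto
    then show "x \<in> {x. a \<bullet> x < c}" by simp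
  qed
  then have "convex hull V \<subseteq> {x. a \<bullet> x < c}" by (intro hull_minimal convex_halfspace_lt)
  moreover obtain x where "x \<in> convex hull U" "x \<in> convex hull V" using UV(4) by blast
  ultimately have "a \<bullet> x > c" "a \<bullet> x < c" by blast+
  then show False by simp
qed

text \<open>
  Three vectors of the plane are dependent even if some of them coincide. The coefficients
  are defined up to a common factor, whose sign can be chosen to satisfy one further inequality.
\<close>
lemma dependent_with_nonpos_combination:
  fixes u v w :: "real^2"
  obtains \<alpha> \<beta> \<gamma> :: real where "(\<alpha>, \<beta>, \<gamma>) \<noteq> (0, 0, 0)" "\<alpha> *\<^sub>R u + \<beta> *\<^sub>R v + \<gamma> *\<^sub>R w = 0"
    "\<alpha> * b + \<beta> * c + \<gamma> * d \<le> 0"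
proof -
  define f :: "real^3 \<Rightarrow> real^2" where "f x = x$1 *\<^sub>R u + x$2 *\<^sub>R v + x$3 *\<^sub>R w" for x
  have lin: "linear f" by (rule linearI) (simp_all add: f_def algebra_simps)
  have "\<not> inj f"
  proof
    assume "inj f"
    then have "dim (range f) = dim (UNIV :: (real^3) set)"
      using lin by (intro dim_image_eq) (auto intro: inj_on_subset)
    then show False using dim_subset_UNIV[of "range f"] by simp
  qed
  then obtain x where x: "x \<noteq> 0" "f x = 0" using linear_injective_0[OF lin] by blast
  have nz: "(x$1, x$2, x$3) \<noteq> (0, 0, 0)" using x(1) by (auto simp: vec_eq_iff forall_3)
  show ?thesis
  proof (cases "x$1 * b + x$2 * c + x$3 * d \<le> 0")
    case True
    then show ?thesis using that nz x(2) unfolding f_def by blast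
  next
    case False
    have "f (- x) = 0" using x(2) lin by (simp add: linear_neg)
    then show ?thesis using that[of "- (x$1)" "- (x$2)" "- (x$3)"] nz False by (simp add: f_def)
  qed
qed

text \<open>
  Three lines never cut the plane into all eight sign patterns. A linear dependence between their
  normal vectors makes some combination of the three affine functions constant, with a nonnegative
  value for a suitable sign of the coefficients. The pattern in which each function has the sign
  opposite to its coefficient would make this combination negative.
\<close>
lemma vc_dim_dual_halfplane_traces: "vc_dim_le 2 (dual_family P (halfplane_traces P))"
  unfolding vc_dim_le_def
proof (intro allI impI notI)
  let ?X = "halfplane_traces P"
  fix Y assume Y: "finite Y \<and> card Y = Suc 2" and sh: "shatters (dual_family P ?X) Y"
  have "Y \<subseteq> ?X" using shatters_subset[OF sh, of ?X] by (auto simp: dual_family_def)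
  moreover obtain S T U where STU: "Y = {S, T, U}" "S \<noteq> T" "S \<noteq> U" "T \<noteq> U"
    using Y card_3_iff[of Y] by auto
  ultimately have "S \<in> ?X" "T \<in> ?X" "U \<in> ?X" by auto
  obtain u b where S: "\<forall>p\<in>P. u \<bullet> p \<noteq> b" "S = {p \<in> P. b < u \<bullet> p}"
    using \<open>S \<in> ?X\<close> by (rule halfplane_traceE)
  obtain v c where T: "\<forall>p\<in>P. v \<bullet> p \<noteq> c" "T = {p \<in> P. c < v \<bullet> p}"
    using \<open>T \<in> ?X\<close> by (rule halfplane_traceE)
  obtain w d where U: "\<forall>p\<in>P. w \<bullet> p \<noteq> d" "U = {p \<in> P. d < w \<bullet> p}"
    using \<open>U \<in> ?X\<close> by (rule halfplane_traceE)
  obtain \<alpha> \<beta> \<gamma> :: real where nz: "(\<alpha>, \<beta>, \<gamma>) \<noteq> (0, 0, 0)"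
    and dep: "\<alpha> *\<^sub>R u + \<beta> *\<^sub>R v + \<gamma> *\<^sub>R w = 0" and le: "\<alpha> * b + \<beta> * c + \<gamma> * d \<le> 0"
    by (rule dependent_with_nonpos_combination)
  \<comment> \<open>At a point with this pattern every term of the combination of the affine functions is nonpositive,
    and a term with nonzero coefficient is negative.\<close>
  define Z where "Z = {A. A = S \<and> \<alpha> < 0 \<or> A = T \<and> \<beta> < 0 \<or> A = U \<and> \<gamma> < 0}"
  have "Z \<subseteq> Y" unfolding Z_def STU(1) by blast
  then obtain B where "B \<in> dual_family P ?X" "B \<inter> Y = Z" using shattersD[OF sh] by blast
  then obtain p where p: "p \<in> P" "{A \<in> ?X. p \<in> A} \<inter> Y = Z"
    unfolding dual_family_def by blast
  have mem: "p \<in> A \<longleftrightarrow> A \<in> Z" if "A \<in> Y" for A using p(2) that \<open>Y \<subseteq> ?X\<close> by blast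
  have "S \<in> Z \<longleftrightarrow> \<alpha> < 0" "T \<in> Z \<longleftrightarrow> \<beta> < 0" "U \<in> Z \<longleftrightarrow> \<gamma> < 0"
    using STU(2-4) unfolding Z_def by blast+
  then have pos: "b < u \<bullet> p \<longleftrightarrow> \<alpha> < 0" "c < v \<bullet> p \<longleftrightarrow> \<beta> < 0" "d < w \<bullet> p \<longleftrightarrow> \<gamma> < 0"
    using mem[of S] mem[of T] mem[of U] p(1) S(2) T(2) U(2) STU(1) by auto
  have sign: "x * (y - z) \<le> 0" "x \<noteq> 0 \<Longrightarrow> x * (y - z) < 0"
    if "z < y \<longleftrightarrow> x < 0" "y \<noteq> z" for x y z :: real
    using that by (auto simp: mult_less_0_iff mult_le_0_iff)
  note \<alpha> = sign[OF pos(1) S(1)[rule_format, OF p(1)]] and \<beta> = sign[OF pos(2) T(1)[rule_format, OF p(1)]]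
    and \<gamma> = sign[OF pos(3) U(1)[rule_format, OF p(1)]]
  have "\<alpha> * (u \<bullet> p - b) + \<beta> * (v \<bullet> p - c) + \<gamma> * (w \<bullet> p - d) < 0"
  proof -
    consider "\<alpha> \<noteq> 0" | "\<beta> \<noteq> 0" | "\<gamma> \<noteq> 0" using nz by auto
    then show ?thesis
      using \<alpha>(1) \<beta>(1) \<gamma>(1) by cases (use \<alpha>(2) \<beta>(2) \<gamma>(2) in linarith)+
  qed
  moreover have "\<alpha> * (u \<bullet> p) + \<beta> * (v \<bullet> p) + \<gamma> * (w \<bullet> p) = (\<alpha> *\<^sub>R u + \<beta> *\<^sub>R v + \<gamma> *\<^sub>R w) \<bullet> p"
    by (simp add: inner_add_left)
  then have "\<alpha> * (u \<bullet> p) + \<beta> * (v \<bullet> p) + \<gamma> * (w \<bullet> p) = 0" using dep by simp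
  ultimately show False using le by (simp add: right_diff_distrib)
qed

lemma line_is_hyperplane:
  assumes "is_line L"
  obtains a :: "real^2" and c where "L = {x. a \<bullet> x = c}"
proof -
  have "aff_dim L = int (DIM(real^2)) - 1" "affine L" using assms by (auto simp: is_line_def)
  then obtain a c where "affine hull L = {x. a \<bullet> x = c}"
    using aff_dim_eq_hyperplane[of L] by auto
  then show ?thesis using that hull_same[of affine L] \<open>affine L\<close> by simp
qed

lemma line_meets_edge_imp_separated:
  assumes "line_meets_edge {x. a \<bullet> x = c} e"
    and "e \<subseteq> P" "\<forall>p\<in>P. a \<bullet> p \<noteq> c"
  shows "e \<inter> {p \<in> P. c < a \<bullet> p} \<noteq> {}" "e - {p \<in> P. c < a \<bullet> p} \<noteq> {}"
proof -
  obtain u v x where e: "e = {u, v}" and x: "a \<bullet> x = c" "x \<in> closed_segment u v"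
    using assms(1) by (auto simp: line_meets_edge_def)
  have hull: "x \<in> convex hull e" using x(2) by (simp add: e segment_convex_hull)
  show "e \<inter> {p \<in> P. c < a \<bullet> p} \<noteq> {}"
  proof
    assume "e \<inter> {p \<in> P. c < a \<bullet> p} = {}"
    then have "\<not> c < a \<bullet> y" "a \<bullet> y \<noteq> c" if "y \<in> e" for y
      using that assms(2,3) by auto
    then have "e \<subseteq> {x. a \<bullet> x < c}" by (auto simp: not_less_iff_gr_or_eq)
    then have "convex hull e \<subseteq> {x. a \<bullet> x < c}" by (intro hull_minimal convex_halfspace_lt)
    then show False using hull x(1) by auto
  qed
  show "e - {p \<in> P. c < a \<bullet> p} \<noteq> {}"
  proof
    assume "e - {p \<in> P. c < a \<bullet> p} = {}"
    then have "e \<subseteq> {x. a \<bullet> x > c}" by auto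
    then have "convex hull e \<subseteq> {x. a \<bullet> x > c}" by (intro hull_minimal convex_halfspace_gt)
    then show False using hull x(1) by auto
  qed
qed

text \<open>
  A line that avoids \<open>P\<close> meets only edges whose ends lie on different sides, so the crossing number is
  governed by how often half-plane traces cut the edge set.
\<close>
lemma crossing_number_le:
  assumes "geometric_graph P E" "\<And>S. S \<in> halfplane_traces P \<Longrightarrow> card (cut S E) \<le> k"
  shows "crossing_number P E \<le> k"
  unfolding crossing_number_def
proof (intro Max.boundedI finite_crossing_counts crossing_counts_nonempty assms(1))
  fix m assume "m \<in> crossing_counts P E"
  then obtain L where m: "m = card {e \<in> E. line_meets_edge L e}" and "is_line L" "L \<inter> P = {}"
    by (auto simp: crossing_counts_def)
  then obtain a c where L: "L = {x. a \<bullet> x = c}" using line_is_hyperplane by blast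
  have avoid: "\<forall>p\<in>P. a \<bullet> p \<noteq> c" using \<open>L \<inter> P = {}\<close> L by auto
  let ?S = "{p \<in> P. c < a \<bullet> p}"
  have "finite (cut ?S E)" using finite_edges[OF assms(1)] by (simp add: cut_def)
  moreover have "{e \<in> E. line_meets_edge L e} \<subseteq> cut ?S E"
  proof
    fix e assume "e \<in> {e \<in> E. line_meets_edge L e}"
    moreover from this have "e \<subseteq> P" using assms(1) by (auto simp: geometric_graph_def)
    ultimately show "e \<in> cut ?S E"
      using line_meets_edge_imp_separated[of a c e P] avoid unfolding L cut_def by blast
  qed
  ultimately have "m \<le> card (cut ?S E)" unfolding m by (rule card_mono)
  also have "?S \<in> halfplane_traces P" using avoid by (auto simp: halfplane_traces_def)
  then have "card (cut ?S E) \<le> k" by (rule assms(2))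
  finally show "m \<le> k" .
qed

section \<open>Spanning trees with low crossing number\<close>

lemma cube_le_exp_sqrt: "(real (Suc n)) ^ 3 \<le> exp (6 * sqrt (real n))"
proof -
  have "real (Suc n) \<le> (1 + sqrt (real n))\<^sup>2" by (simp add: power2_sum)
  also have "\<dots> \<le> (exp (sqrt (real n)))\<^sup>2" by (intro power_mono exp_ge_add_one_self) auto
  finally have "real (Suc n) ^ 3 \<le> ((exp (sqrt (real n)))\<^sup>2) ^ 3" by (intro power_mono) auto
  also have "\<dots> = exp (6 * sqrt (real n))"
    by (simp flip: power_mult exp_of_nat_mult)
  finally show ?thesis .
qed

lemma exponent_le_of_two_power_le_exp:
  assumes "2 ^ k \<le> exp x"
  shows "real k \<le> 3 / 2 * x"
proof -
  have "real k * ln 2 \<le> x"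
    using assms ln_le_cancel_iff[of "2 ^ k" "exp x"] by (simp add: ln_realpow)
  moreover have "real k * (2 / 3) \<le> real k * ln 2"
    using ln2_ge_two_thirds by (intro mult_left_mono) auto
  ultimately show ?thesis by linarith
qed

text \<open>
  The total weight is at most \<open>exp ((6 + 64) * sqrt n)\<close> in the end, the 6 coming from the number of
  half-plane traces and the 64 from the reweighting. As \<open>1 / ln 2 \<le> 3 / 2\<close>, this gives the constant
  \<open>105 = 3 / 2 * 70\<close>.
\<close>
theorem theorem1p3:
  shows "\<exists>A::real. A > 0 \<and>
    (\<forall>n::nat. n > 0 \<longrightarrow>
      (\<forall>P::(real^2) set. finite P \<and> card P = n \<longrightarrow>
        (\<exists>E. geometric_spanning_tree P E \<and> real (crossing_number P E) \<le> A * sqrt (real n))))"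
proof (intro exI[of _ 105] conjI allI impI)
  fix n :: nat and P :: "(real^2) set"
  assume "0 < n" and P: "finite P \<and> card P = n"
  let ?X = "halfplane_traces P"
  have finX: "finite ?X" using P finite_subset[OF halfplane_traces_subset] by blast
  have "P \<noteq> {}" using P \<open>0 < n\<close> by auto
  then obtain E where tree: "spanning_tree P E"
    and pot: "(\<Sum>S\<in>?X. 1 * 2 ^ card (cut S E)) \<le> (\<Sum>S\<in>?X. 1) * exp (64 * sqrt (real (card P)))"
    using spanning_tree_small_potential[of P ?X "\<lambda>_. 1"] P finX vc_dim_dual_halfplane_traces by auto
  have gtree: "geometric_spanning_tree P E"
    using tree P by (auto simp: spanning_tree_def geometric_spanning_tree_def geometric_graph_def)
  have "card ?X \<le> Suc n ^ 3"
    using P sauer_shelah[OF _ halfplane_traces_subset vc_dim_halfplane_traces] by blast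
  then have "real (card ?X) \<le> real (Suc n) ^ 3" using of_nat_mono[of "card ?X" "Suc n ^ 3"] by simp
  then have cardX: "real (card ?X) \<le> exp (6 * sqrt (real n))"
    using cube_le_exp_sqrt order_trans by blast
  have "card (cut S E) \<le> nat \<lfloor>105 * sqrt (real n)\<rfloor>" if "S \<in> ?X" for S
  proof -
    have "2 ^ card (cut S E) \<le> (\<Sum>S\<in>?X. 2 ^ card (cut S E) :: real)"
      using that finX by (intro member_le_sum) auto
    also have "\<dots> \<le> real (card ?X) * exp (64 * sqrt (real n))"
      using pot P by simp
    also have "\<dots> \<le> exp (6 * sqrt (real n)) * exp (64 * sqrt (real n))"
      using cardX by (rule mult_right_mono) simp
    also have "\<dots> = exp (70 * sqrt (real n))" by (simp flip: exp_add)
    finally have "real (card (cut S E)) \<le> 3 / 2 * (70 * sqrt (real n))"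
      by (rule exponent_le_of_two_power_le_exp)
    then show ?thesis by (simp add: le_nat_floor)
  qed
  then have "crossing_number P E \<le> nat \<lfloor>105 * sqrt (real n)\<rfloor>"
    using gtree by (intro crossing_number_le) (auto simp: geometric_spanning_tree_def)
  moreover have "real (nat \<lfloor>105 * sqrt (real n)\<rfloor>) \<le> 105 * sqrt (real n)"
    by (rule of_nat_floor) simp
  ultimately have "real (crossing_number P E) \<le> 105 * sqrt (real n)" by linarith
  then show "\<exists>E. geometric_spanning_tree P E \<and> real (crossing_number P E) \<le> 105 * sqrt (real n)"
    using gtree by blast
qed simp

end
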